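(* Let $m,N,s\ge 1$ be integers, let $\kappa>0$, and let $A\in\mathbb{R}^{m\times N}$ be a matrix with all entries $A_{j,k}\in\{-1,+1\}$. Assume that (a) $\displaystyle \Big|\sum_{j=1}^m A_{j,k}A_{j,k'}\Big|\le \kappa\sqrt{m}$ for all distinct $k,k'\in\{1,\dots,N\}$; (b) $\displaystyle \Big|\sum_{j=1}^m A_{j,k}A_{j,k'}A_{j,\ell}A_{j,\ell'}\Big|\le \kappa\sqrt{m}$ for all (pairwise) distinct $k,k',\ell,\ell'\in\{1,\dots,N\}$. Then, for any $\delta\in(0,1)$, as soon as $m\ge \kappa^2\delta^{-2}s^4$, there exist constants $\alpha,\beta>0$ with $$\frac{\beta}{\alpha}\le \sqrt{3}\left(\frac{1+\delta}{1-\delta}\right)^{3/2}$$ such that $$\alpha\, m\,\|x\|_2\le \|Ax\|_1\le \beta\, m\,\|x\|_2\qquad\text{for all $s$-sparse } x\in\mathbb{R}^N.$$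
   Context: A vector $x\in\mathbb{R}^N$ is called $s$-sparse if it has at most $s$ nonzero entries. $\|\cdot\|_p$ denotes the usual (unnormalized) $\ell_p$-norm: $\|y\|_p=(\sum_i|y_i|^p)^{1/p}$. *)

theory Defs
  imports "HOL-Analysis.Analysis"
begin

definition s_sparse :: "nat \<Rightarrow> real ^ 'n \<Rightarrow> bool" where
  "s_sparse s x \<longleftrightarrow> card {i. x $ i \<noteq> 0} \<le> s"

(* 0 powr p = 0 for every p, as required for zero entries. *)
definition lp_norm :: "real \<Rightarrow> real ^ 'n \<Rightarrow> real" where
  "lp_norm p y = (\<Sum>i\<in>UNIV. \<bar>y $ i\<bar> powr p) powr (1 / p)"

lemma lp_norm_1: "lp_norm 1 y = (\<Sum>i\<in>UNIV. \<bar>y $ i\<bar>)"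
  by (simp add: lp_norm_def sum_nonneg)

lemma lp_norm_2: "lp_norm 2 y = norm y"
proof -
  have "(\<Sum>i\<in>UNIV. \<bar>y $ i\<bar> powr 2) = (\<Sum>i\<in>UNIV. (y $ i)\<^sup>2)"
    by (rule sum.cong) (auto simp: powr_numeral)
  then show ?thesis
    by (simp add: lp_norm_def norm_vec_def L2_set_def powr_half_sqrt sum_nonneg)
qed

end

theory Submission
  imports Defs
begin

text \<open>The second moment of \<open>A x\<close> is within a factor \<open>1 \<plusminus> \<delta>\<close> of \<open>m \<parallel>x\<parallel>\<^sup>2\<close> by (a). In the fourth moment, the
  index quadruples that split into two equal pairs contribute at most \<open>3 m \<parallel>x\<parallel>\<^sup>4\<close>; every other
  quadruple has correlation at most \<open>\<kappa> \<surd>m\<close>, by (b) if its indices are distinct, and by (a) if two of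
  them cancel because of \<open>A\<^sub>j\<^sub>k\<^sup>2 = 1\<close>. The upper bound is then Cauchy-Schwarz, and the lower bound
  is the interpolation inequality \<open>\<parallel>y\<parallel>\<^sub>2\<^sup>6 \<le> \<parallel>y\<parallel>\<^sub>1\<^sup>2 \<parallel>y\<parallel>\<^sub>4\<^sup>4\<close>.\<close>

text \<open>Two applications of Cauchy-Schwarz meet in the third absolute moment:
  \<open>S2^2 <= S1 * S3\<close> and \<open>S3^2 <= S2 * S4\<close>. Squaring the first and
  inserting the second eliminates \<open>S3\<close>, and one factor \<open>S2\<close>
  cancels.\<close>

lemma sum_cubed_power2_le:
  fixes y :: "'a \<Rightarrow> real"
  shows "(\<Sum>i\<in>I. (y i)\<^sup>2) ^ 3 \<le> (\<Sum>i\<in>I. \<bar>y i\<bar>)\<^sup>2 * (\<Sum>i\<in>I. y i ^ 4)"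
proof -
  define S1 S2 S3 S4 where "S1 = (\<Sum>i\<in>I. \<bar>y i\<bar>)" and "S2 = (\<Sum>i\<in>I. (y i)\<^sup>2)"
    and "S3 = (\<Sum>i\<in>I. \<bar>y i\<bar> ^ 3)" and "S4 = (\<Sum>i\<in>I. y i ^ 4)"
  have nonneg: "0 \<le> S1" "0 \<le> S2" "0 \<le> S4"
    by (auto simp: S1_def S2_def S4_def intro: sum_nonneg)
  \<comment> \<open>The square is split into the powers 1/2 and 3/2 of the absolute value, so that
    the squares of the two factors are the summands of \<open>S1\<close> and
    \<open>S3\<close>.\<close>
  have "(\<Sum>i\<in>I. sqrt \<bar>y i\<bar> * (\<bar>y i\<bar> * sqrt \<bar>y i\<bar>)) = S2"
    unfolding S2_def by (intro sum.cong refl) (simp add: mult.left_commute power2_eq_square)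
  moreover have "(\<Sum>i\<in>I. (\<bar>y i\<bar> * sqrt \<bar>y i\<bar>)\<^sup>2) = S3"
    unfolding S3_def
    by (intro sum.cong refl) (simp add: power_mult_distrib, simp add: power2_eq_square power3_eq_cube)
  ultimately have CS1: "S2\<^sup>2 \<le> S1 * S3"
    using Cauchy_Schwarz_ineq_sum[of "\<lambda>i. sqrt \<bar>y i\<bar>" "\<lambda>i. \<bar>y i\<bar> * sqrt \<bar>y i\<bar>" I]
    by (simp add: S1_def)
  have "(\<Sum>i\<in>I. \<bar>y i\<bar> * (y i)\<^sup>2) = S3"
    unfolding S3_def by (intro sum.cong refl) (simp add: power2_eq_square power3_eq_cube)
  then have CS2: "S3\<^sup>2 \<le> S2 * S4"
    using Cauchy_Schwarz_ineq_sum[of "\<lambda>i. \<bar>y i\<bar>" "\<lambda>i. (y i)\<^sup>2" I]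
    by (simp add: S2_def S4_def)
  have "S2 * S2 ^ 3 = (S2\<^sup>2)\<^sup>2"
    by (simp add: power2_eq_square power3_eq_cube)
  also have "\<dots> \<le> (S1 * S3)\<^sup>2"
    using CS1 by (intro power_mono) auto
  also have "\<dots> \<le> S1\<^sup>2 * (S2 * S4)"
    using CS2 by (simp add: power_mult_distrib mult_left_mono)
  finally have "S2 * S2 ^ 3 \<le> S2 * (S1\<^sup>2 * S4)"
    by (simp add: mult_ac)
  then have "S2 ^ 3 \<le> S1\<^sup>2 * S4"
    using nonneg by (cases "S2 = 0") auto
  then show ?thesis
    by (simp add: S1_def S2_def S4_def)
qed

text \<open>Cauchy-Schwarz against the constant 1 on the support only. Sparsity enters the whole
  argument through this estimate.\<close>

lemma s_sparse_l1_power2_le: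
  assumes "s_sparse s x"
  shows "(\<Sum>k\<in>UNIV. \<bar>x $ k\<bar>)\<^sup>2 \<le> real s * (\<Sum>k\<in>UNIV. (x $ k)\<^sup>2)"
proof -
  let ?S = "{k. x $ k \<noteq> 0}"
  have "(\<Sum>k\<in>UNIV. \<bar>x $ k\<bar>) = (\<Sum>k\<in>?S. 1 * \<bar>x $ k\<bar>)"
    by (intro sum.mono_neutral_cong_right) auto
  also have "\<dots>\<^sup>2 \<le> real (card ?S) * (\<Sum>k\<in>?S. (x $ k)\<^sup>2)"
    using Cauchy_Schwarz_ineq_sum[of "\<lambda>_. 1" "\<lambda>k. \<bar>x $ k\<bar>" ?S] by simp
  also have "(\<Sum>k\<in>?S. (x $ k)\<^sup>2) = (\<Sum>k\<in>UNIV. (x $ k)\<^sup>2)"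
    by (intro sum.mono_neutral_cong_left) auto
  also have "real (card ?S) * \<dots> \<le> real s * \<dots>"
    using assms by (intro mult_right_mono) (auto simp: s_sparse_def sum_nonneg)
  finally show ?thesis .
qed

text \<open>The second moment is the quadratic form of the Gram matrix \<open>T\<close> of the
  columns. Its diagonal is exactly m because signs square to 1, so it differs from \<open>D\<close>,
  m times the identity, by at most \<open>c\<close> in each entry. Such a perturbation changes the
  form by at most \<open>c\<close> times the squared l1-norm of \<open>x\<close>.\<close>

lemma second_moment_error:
  fixes A :: "real ^ 'n ^ 'm" and x :: "real ^ 'n"
  assumes sign: "\<forall>j k. A $ j $ k \<in> {-1, 1}"
    and pair: "\<forall>k k'. k \<noteq> k' \<longrightarrow> \<bar>\<Sum>j\<in>UNIV. A $ j $ k * A $ j $ k'\<bar> \<le> c"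
    and "0 \<le> c"
  shows "\<bar>(\<Sum>j\<in>UNIV. ((A *v x) $ j)\<^sup>2) - real CARD('m) * (\<Sum>k\<in>UNIV. (x $ k)\<^sup>2)\<bar>
    \<le> c * (\<Sum>k\<in>UNIV. \<bar>x $ k\<bar>)\<^sup>2"
proof -
  define T where "T k l = (\<Sum>j\<in>UNIV. A $ j $ k * A $ j $ l)" for k l
  define D where "D k l = (if k = l then real CARD('m) else 0)" for k l :: 'n
  have sq: "A $ j $ k * A $ j $ k = 1" for j k
    using sign[rule_format, of j k] by auto
  have T_near: "\<bar>T k l - D k l\<bar> \<le> c" for k l
    using pair \<open>0 \<le> c\<close> by (auto simp: T_def D_def sq)
  have "(\<Sum>j\<in>UNIV. ((A *v x) $ j)\<^sup>2)
      = (\<Sum>j\<in>UNIV. \<Sum>k\<in>UNIV. \<Sum>l\<in>UNIV. (x $ k * x $ l) * (A $ j $ k * A $ j $ l))"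
    by (simp add: matrix_vector_mult_def power2_eq_square sum_product mult_ac)
  also have "\<dots> = (\<Sum>k\<in>UNIV. \<Sum>j\<in>UNIV. \<Sum>l\<in>UNIV. (x $ k * x $ l) * (A $ j $ k * A $ j $ l))"
    by (rule sum.swap)
  also have "\<dots> = (\<Sum>k\<in>UNIV. \<Sum>l\<in>UNIV. \<Sum>j\<in>UNIV. (x $ k * x $ l) * (A $ j $ k * A $ j $ l))"
    by (intro sum.cong refl sum.swap)
  also have "\<dots> = (\<Sum>k\<in>UNIV. \<Sum>l\<in>UNIV. x $ k * x $ l * T k l)"
    by (simp add: T_def sum_distrib_left)
  finally have moment: "(\<Sum>j\<in>UNIV. ((A *v x) $ j)\<^sup>2) = \<dots>" .
  have "real CARD('m) * (\<Sum>k\<in>UNIV. (x $ k)\<^sup>2) = (\<Sum>k\<in>UNIV. \<Sum>l\<in>UNIV. x $ k * x $ l * D k l)"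
    by (simp add: D_def sum_distrib_left power2_eq_square if_distrib mult_ac cong: if_cong)
  then have "\<bar>(\<Sum>j\<in>UNIV. ((A *v x) $ j)\<^sup>2) - real CARD('m) * (\<Sum>k\<in>UNIV. (x $ k)\<^sup>2)\<bar>
      = \<bar>\<Sum>k\<in>UNIV. \<Sum>l\<in>UNIV. x $ k * x $ l * (T k l - D k l)\<bar>"
    by (simp add: moment sum_subtractf right_diff_distrib)
  also have "\<dots> \<le> (\<Sum>k\<in>UNIV. \<Sum>l\<in>UNIV. \<bar>x $ k\<bar> * \<bar>x $ l\<bar> * c)"
    by (intro order_trans[OF sum_abs] sum_mono)
      (auto simp: abs_mult intro!: mult_left_mono T_near)
  also have "\<dots> = c * (\<Sum>k\<in>UNIV. \<bar>x $ k\<bar>)\<^sup>2"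
    by (simp add: power2_eq_square sum_product sum_distrib_left mult_ac)
  finally show ?thesis .
qed

text \<open>The three indicators are the three ways to match four indices into two equal pairs. They
  are added rather than joined by a disjunction, so that each can be summed separately later; where
  matchings overlap, the bound only gets weaker.\<close>

lemma fourth_correlation_le:
  fixes A :: "real ^ 'n ^ 'm"
  assumes sign: "\<forall>j k. A $ j $ k \<in> {-1, 1}"
    and pair: "\<forall>k k'. k \<noteq> k' \<longrightarrow> \<bar>\<Sum>j\<in>UNIV. A $ j $ k * A $ j $ k'\<bar> \<le> c"
    and quad: "\<forall>k k' l l'. distinct [k, k', l, l'] \<longrightarrow>
      \<bar>\<Sum>j\<in>UNIV. A $ j $ k * A $ j $ k' * A $ j $ l * A $ j $ l'\<bar> \<le> c"
    and "0 \<le> c"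
  shows "\<bar>\<Sum>j\<in>UNIV. A $ j $ k * A $ j $ k' * A $ j $ l * A $ j $ l'\<bar>
    \<le> real CARD('m) * (of_bool (k = k' \<and> l = l') + of_bool (k = l \<and> k' = l')
        + of_bool (k = l' \<and> k' = l)) + c"
proof -
  have sq: "A $ j $ p * A $ j $ p = 1" for j p
    using sign[rule_format, of j p] by auto
  have cancel: "A $ j $ p * (A $ j $ p * z) = z" for j p z
    using sq[of j p] by (simp flip: mult.assoc)
  have pair_le: "\<bar>\<Sum>j\<in>UNIV. A $ j $ p * A $ j $ q\<bar> \<le> real CARD('m) * of_bool (p = q) + c" for p q
    using pair \<open>0 \<le> c\<close> by (auto simp: sq)
  \<comment> \<open>Here \<open>p\<close> and \<open>q\<close> are the two indices left once an
    equal pair has cancelled. If they differ, the pair hypothesis gives \<open>c\<close>; if they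
    agree, the sum is m, and \<open>eq\<close> guarantees that some indicator pays for it.\<close>
  have reduce: ?thesis
    if prod: "\<And>j. A $ j $ k * A $ j $ k' * A $ j $ l * A $ j $ l' = A $ j $ p * A $ j $ q"
      and eq: "p = q \<Longrightarrow> k = k' \<and> l = l' \<or> k = l \<and> k' = l' \<or> k = l' \<and> k' = l" for p q
  proof -
    have union_bound: "of_bool b \<le> of_bool b1 + of_bool b2 + (of_bool b3 :: real)"
      if "b \<Longrightarrow> b1 \<or> b2 \<or> b3" for b b1 b2 b3
      using that by (cases b; cases b1; cases b2; cases b3) simp_all
    have "of_bool (p = q) \<le> of_bool (k = k' \<and> l = l') + of_bool (k = l \<and> k' = l')
        + (of_bool (k = l' \<and> k' = l) :: real)"
      by (rule union_bound) (rule eq)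
    then have "real CARD('m) * of_bool (p = q) \<le> real CARD('m) * (of_bool (k = k' \<and> l = l')
        + of_bool (k = l \<and> k' = l') + of_bool (k = l' \<and> k' = l))"
      by (rule mult_left_mono) simp
    then show ?thesis
      using pair_le[of p q] by (simp only: prod)
  qed
  consider "distinct [k, k', l, l']" | "k = k'" | "l = l'" | "k = l" | "k' = l'" | "k = l'" | "k' = l"
    by auto
  then show ?thesis
  proof cases
    case 1
    then show ?thesis using quad by simp
  next
    case 2
    then show ?thesis by (intro reduce[of l l']) (auto simp: cancel sq mult_ac)
  next
    case 3
    then show ?thesis by (intro reduce[of k k']) (auto simp: cancel sq mult_ac)
  next
    case 4
    then show ?thesis by (intro reduce[of k' l']) (auto simp: cancel sq mult_ac)
  next
    case 5
    then show ?thesis by (intro reduce[of k l]) (auto simp: cancel sq mult_ac)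
  next
    case 6
    then show ?thesis by (intro reduce[of k' l]) (auto simp: cancel sq mult_ac)
  next
    case 7
    then show ?thesis by (intro reduce[of k l']) (auto simp: cancel sq mult_ac)
  qed
qed

lemma sum_power4:
  fixes f :: "'a \<Rightarrow> real"
  shows "(\<Sum>k\<in>I. f k) ^ 4 = (\<Sum>k\<in>I. \<Sum>k'\<in>I. \<Sum>l\<in>I. \<Sum>l'\<in>I. f k * f k' * f l * f l')"
proof -
  have "(\<Sum>k\<in>I. f k) ^ 4 = (\<Sum>k\<in>I. f k) * ((\<Sum>k\<in>I. f k) * ((\<Sum>k\<in>I. f k) * (\<Sum>k\<in>I. f k)))"
    by (simp add: power4_eq_xxxx mult_ac)
  also have "\<dots> = (\<Sum>k\<in>I. \<Sum>k'\<in>I. \<Sum>l\<in>I. \<Sum>l'\<in>I. f k * f k' * f l * f l')"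
    by (simp only: sum_product) (simp only: sum_distrib_left mult.assoc)
  finally show ?thesis .
qed

text \<open>After expansion each quadruple has weight at most \<open>w\<close> and a correlation
  bounded by the previous lemma. The \<open>c\<close> part sums to the fourth power of the l1-norm;
  each of the three matchings leaves two free indices and contributes m times the square of the sum
  of squares.\<close>

lemma fourth_moment_le:
  fixes A :: "real ^ 'n ^ 'm" and x :: "real ^ 'n"
  assumes sign: "\<forall>j k. A $ j $ k \<in> {-1, 1}"
    and pair: "\<forall>k k'. k \<noteq> k' \<longrightarrow> \<bar>\<Sum>j\<in>UNIV. A $ j $ k * A $ j $ k'\<bar> \<le> c"
    and quad: "\<forall>k k' l l'. distinct [k, k', l, l'] \<longrightarrow>
      \<bar>\<Sum>j\<in>UNIV. A $ j $ k * A $ j $ k' * A $ j $ l * A $ j $ l'\<bar> \<le> c"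
    and "0 \<le> c"
  shows "(\<Sum>j\<in>UNIV. ((A *v x) $ j) ^ 4)
    \<le> 3 * real CARD('m) * (\<Sum>k\<in>UNIV. (x $ k)\<^sup>2)\<^sup>2 + c * (\<Sum>k\<in>UNIV. \<bar>x $ k\<bar>) ^ 4"
proof -
  define T where "T k k' l l' = (\<Sum>j\<in>UNIV. A $ j $ k * A $ j $ k' * A $ j $ l * A $ j $ l')"
    for k k' l l'
  define P :: "'n \<Rightarrow> 'n \<Rightarrow> 'n \<Rightarrow> 'n \<Rightarrow> real" where
    "P k k' l l' = of_bool (k = k' \<and> l = l') + of_bool (k = l \<and> k' = l')
      + of_bool (k = l' \<and> k' = l)" for k k' l l'
  define w where "w k k' l l' = \<bar>x $ k\<bar> * \<bar>x $ k'\<bar> * \<bar>x $ l\<bar> * \<bar>x $ l'\<bar>" for k k' l l'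
  have "(\<Sum>j\<in>UNIV. ((A *v x) $ j) ^ 4) = (\<Sum>j\<in>UNIV. \<Sum>k\<in>UNIV. \<Sum>k'\<in>UNIV. \<Sum>l\<in>UNIV. \<Sum>l'\<in>UNIV.
      (x $ k * x $ k' * x $ l * x $ l') * (A $ j $ k * A $ j $ k' * A $ j $ l * A $ j $ l'))"
    by (simp add: matrix_vector_mult_def sum_power4 mult_ac)
  also have "\<dots> = (\<Sum>k\<in>UNIV. \<Sum>k'\<in>UNIV. \<Sum>l\<in>UNIV. \<Sum>l'\<in>UNIV. \<Sum>j\<in>UNIV.
      (x $ k * x $ k' * x $ l * x $ l') * (A $ j $ k * A $ j $ k' * A $ j $ l * A $ j $ l'))"
    \<comment> \<open>Each round moves the sum over \<open>j\<close> one place inward, past one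
      column index.\<close>
    by (rule trans[OF sum.swap], rule sum.cong[OF refl])+ (rule refl)
  also have "\<dots> = (\<Sum>k\<in>UNIV. \<Sum>k'\<in>UNIV. \<Sum>l\<in>UNIV. \<Sum>l'\<in>UNIV.
      (x $ k * x $ k' * x $ l * x $ l') * T k k' l l')"
    by (simp add: T_def sum_distrib_left)
  also have "\<dots> \<le> (\<Sum>k\<in>UNIV. \<Sum>k'\<in>UNIV. \<Sum>l\<in>UNIV. \<Sum>l'\<in>UNIV.
      w k k' l l' * (real CARD('m) * P k k' l l' + c))"
  proof (intro sum_mono)
    fix k k' l l'
    have "(x $ k * x $ k' * x $ l * x $ l') * T k k' l l' \<le> w k k' l l' * \<bar>T k k' l l'\<bar>"
      unfolding w_def by (metis abs_ge_self abs_mult)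
    also have "\<dots> \<le> w k k' l l' * (real CARD('m) * P k k' l l' + c)"
      using fourth_correlation_le[OF assms, of k k' l l']
      by (intro mult_left_mono) (auto simp: w_def T_def P_def)
    finally show "(x $ k * x $ k' * x $ l * x $ l') * T k k' l l'
      \<le> w k k' l l' * (real CARD('m) * P k k' l l' + c)" .
  qed
  also have "\<dots> = real CARD('m) * (\<Sum>k\<in>UNIV. \<Sum>k'\<in>UNIV. \<Sum>l\<in>UNIV. \<Sum>l'\<in>UNIV. w k k' l l' * P k k' l l')
      + c * (\<Sum>k\<in>UNIV. \<Sum>k'\<in>UNIV. \<Sum>l\<in>UNIV. \<Sum>l'\<in>UNIV. w k k' l l')"
    by (simp add: distrib_left sum.distrib sum_distrib_left mult_ac)
  also have "(\<Sum>k\<in>UNIV. \<Sum>k'\<in>UNIV. \<Sum>l\<in>UNIV. \<Sum>l'\<in>UNIV. w k k' l l') = (\<Sum>k\<in>UNIV. \<bar>x $ k\<bar>) ^ 4"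
    by (simp add: sum_power4 w_def)
  also have "(\<Sum>k\<in>UNIV. \<Sum>k'\<in>UNIV. \<Sum>l\<in>UNIV. \<Sum>l'\<in>UNIV. w k k' l l' * P k k' l l')
      = 3 * (\<Sum>k\<in>UNIV. (x $ k)\<^sup>2)\<^sup>2"
  proof -
    \<comment> \<open>Nested conditionals with one equation each let the simplifier collapse one sum
      at a time. \<open>delta\<close> moves the weight into the conditional, and \<open>zero\<close>
      moves out conditions that do not involve the summation index.\<close>
    have P_eq: "P k k' l l' = (if k = k' then (if l = l' then 1 else 0) else 0)
        + (if k = l then (if k' = l' then 1 else 0) else 0)
        + (if k = l' then (if k' = l then 1 else 0) else 0)" for k k' l l'
      by (simp add: P_def)
    have delta: "w * (if b then z else 0) = (if b then w * z else 0)" for w z :: real and b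
      by simp
    have zero: "(\<Sum>i\<in>UNIV. if b then f i else 0) = (if b then (\<Sum>i\<in>UNIV. f i) else 0)"
      for b and f :: "'n \<Rightarrow> real"
      by simp
    have "(\<Sum>k\<in>UNIV. \<Sum>k'\<in>UNIV. \<Sum>l\<in>UNIV. \<Sum>l'\<in>UNIV. w k k' l l' * P k k' l l')
        = (\<Sum>k\<in>UNIV. \<Sum>l\<in>UNIV. w k k l l) + (\<Sum>k\<in>UNIV. \<Sum>k'\<in>UNIV. w k k' k k')
          + (\<Sum>k\<in>UNIV. \<Sum>k'\<in>UNIV. w k k' k' k)"
      by (simp add: P_eq distrib_left sum.distrib delta zero)
    also have "\<dots> = 3 * (\<Sum>k\<in>UNIV. \<Sum>l\<in>UNIV. (x $ k)\<^sup>2 * (x $ l)\<^sup>2)"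
    proof -
      have "w k k l l = (x $ k)\<^sup>2 * (x $ l)\<^sup>2" "w k l k l = (x $ k)\<^sup>2 * (x $ l)\<^sup>2"
          "w k l l k = (x $ k)\<^sup>2 * (x $ l)\<^sup>2" for k l
        by (simp_all add: w_def power2_eq_square flip: abs_mult) (simp_all add: abs_mult mult_ac)
      then show ?thesis by simp
    qed
    finally show ?thesis
      by (simp add: power2_eq_square[of "sum _ _"] sum_product)
  qed
  finally show ?thesis by (simp add: mult_ac)
qed

theorem theorem1:
  fixes A :: "real ^ 'N ^ 'm" and s :: nat and \<kappa> \<delta> :: real
  assumes "s \<ge> 1"
    and "\<kappa> > 0"
    and "\<forall>j k. A $ j $ k \<in> {-1, 1}"
    and "\<forall>k k'. k \<noteq> k' \<longrightarrow>
      \<bar>\<Sum>j\<in>UNIV. A $ j $ k * A $ j $ k'\<bar> \<le> \<kappa> * sqrt (real CARD('m))"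
    and "\<forall>k k' l l'. distinct [k, k', l, l'] \<longrightarrow>
      \<bar>\<Sum>j\<in>UNIV. A $ j $ k * A $ j $ k' * A $ j $ l * A $ j $ l'\<bar>
        \<le> \<kappa> * sqrt (real CARD('m))"
    and "0 < \<delta>" and "\<delta> < 1"
    and "real CARD('m) \<ge> \<kappa>\<^sup>2 * \<delta> powi (-2) * real s ^ 4"
  shows "\<exists>\<alpha> \<beta> :: real. \<alpha> > 0 \<and> \<beta> > 0 \<and>
      \<beta> / \<alpha> \<le> sqrt 3 * ((1 + \<delta>) / (1 - \<delta>)) powr (3 / 2) \<and>
      (\<forall>x :: real ^ 'N. s_sparse s x \<longrightarrow>
        \<alpha> * real CARD('m) * lp_norm 2 x \<le> lp_norm 1 (A *v x) \<and>
        lp_norm 1 (A *v x) \<le> \<beta> * real CARD('m) * lp_norm 2 x)"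
proof -
  define m where "m = real CARD('m)"
  define c where "c = \<kappa> * sqrt m"
  have m: "0 < m" by (simp add: m_def)
  have c: "0 \<le> c" using assms(2) m by (simp add: c_def)
  \<comment> \<open>This is the square root of the lower bound on m, multiplied by
    \<open>sqrt m\<close>: it turns the correlation errors into the relative error \<delta>.\<close>
  have c_s: "c * (real s)\<^sup>2 \<le> \<delta> * m"
  proof -
    have "\<delta>\<^sup>2 * \<delta> powi (-2) = 1"
      using assms(6) by (simp add: power_int_minus)
    then have "(\<kappa> * (real s)\<^sup>2)\<^sup>2 = \<delta>\<^sup>2 * (\<kappa>\<^sup>2 * \<delta> powi (-2) * real s ^ 4)"
      by algebra
    also have "\<dots> \<le> \<delta>\<^sup>2 * m"
      unfolding m_def by (intro mult_left_mono assms(8)) simp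
    also have "\<dots> = (\<delta> * sqrt m)\<^sup>2"
      using m by (simp add: power_mult_distrib)
    finally have "\<kappa> * (real s)\<^sup>2 \<le> \<delta> * sqrt m"
      by (rule power2_le_imp_le) (use assms(6) m in simp)
    then have "\<kappa> * (real s)\<^sup>2 * sqrt m \<le> \<delta> * sqrt m * sqrt m"
      by (rule mult_right_mono) (use m in simp)
    then show ?thesis using m by (simp add: c_def mult_ac)
  qed
  \<comment> \<open>Both constants are read off from the moments: \<beta> from
    \<open>S1^2 <= m * S2\<close>, and \<alpha> from \<open>S1^2 >= S2^3 / S4\<close> with the lower
    bound for \<open>S2\<close> and the upper bound for \<open>S4\<close>.\<close>
  define \<alpha> where "\<alpha> = sqrt ((1 - \<delta>) ^ 3 / (3 * (1 + \<delta>)))"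
  define \<beta> where "\<beta> = sqrt (1 + \<delta>)"
  have \<alpha>: "0 < \<alpha>" and \<beta>: "0 < \<beta>" using assms(6,7) by (auto simp: \<alpha>_def \<beta>_def)
  have ratio: "\<beta> / \<alpha> \<le> sqrt 3 * ((1 + \<delta>) / (1 - \<delta>)) powr (3 / 2)"
  proof -
    have "((1 + \<delta>) / (1 - \<delta>)) powr (3 / 2) = sqrt (((1 + \<delta>) / (1 - \<delta>)) ^ 3)"
      using assms(6,7) by (simp add: powr_half_sqrt[symmetric] powr_powr flip: powr_numeral)
    then have "sqrt 3 * ((1 + \<delta>) / (1 - \<delta>)) powr (3 / 2) = sqrt (3 * ((1 + \<delta>) / (1 - \<delta>)) ^ 3)"
      by (simp add: real_sqrt_mult)
    moreover have "\<beta> / \<alpha> = sqrt (3 * (1 + \<delta>)\<^sup>2 / (1 - \<delta>) ^ 3)"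
      by (simp add: \<alpha>_def \<beta>_def power2_eq_square mult_ac flip: real_sqrt_divide)
    \<comment> \<open>The constants give exponent 2 in the numerator; the claimed bound has exponent
      3, which is larger since 1 + \<delta> exceeds 1.\<close>
    moreover have "3 * (1 + \<delta>)\<^sup>2 / (1 - \<delta>) ^ 3 \<le> 3 * ((1 + \<delta>) / (1 - \<delta>)) ^ 3"
    proof -
      have "(1 + \<delta>)\<^sup>2 \<le> (1 + \<delta>) ^ 3"
        using assms(6) by (intro power_increasing) auto
      then show ?thesis
        using assms(7) by (simp add: power_divide divide_right_mono)
    qed
    ultimately show ?thesis by simp
  qed
  have bounds: "\<alpha> * m * lp_norm 2 x \<le> lp_norm 1 (A *v x) \<and> lp_norm 1 (A *v x) \<le> \<beta> * m * lp_norm 2 x"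
    if sparse: "s_sparse s x" for x :: "real ^ 'N"
  proof -
    define n where "n = norm x"
    define L where "L = (\<Sum>k\<in>UNIV. \<bar>x $ k\<bar>)"
    define S1 S2 S4 where "S1 = (\<Sum>j\<in>UNIV. \<bar>(A *v x) $ j\<bar>)"
      and "S2 = (\<Sum>j\<in>UNIV. ((A *v x) $ j)\<^sup>2)" and "S4 = (\<Sum>j\<in>UNIV. ((A *v x) $ j) ^ 4)"
    have n: "0 \<le> n" and S1: "0 \<le> S1"
      by (auto simp: n_def S1_def sum_nonneg)
    have n2: "(\<Sum>k\<in>UNIV. (x $ k)\<^sup>2) = n\<^sup>2"
      by (simp add: n_def norm_vec_def L2_set_def sum_nonneg)
    have L2: "L\<^sup>2 \<le> real s * n\<^sup>2"
      using s_sparse_l1_power2_le[OF sparse] by (simp add: L_def n2)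
    then have "(L\<^sup>2)\<^sup>2 \<le> (real s * n\<^sup>2)\<^sup>2"
      by (intro power_mono) auto
    then have L4: "L ^ 4 \<le> (real s)\<^sup>2 * n ^ 4"
      by (simp add: power_mult_distrib flip: power_mult)
    have c_L4: "c * L ^ 4 \<le> \<delta> * m * n ^ 4"
    proof -
      have "c * L ^ 4 \<le> c * (real s)\<^sup>2 * n ^ 4"
        using mult_left_mono[OF L4 c] by (simp add: mult_ac)
      also have "\<dots> \<le> \<delta> * m * n ^ 4"
        using c_s by (intro mult_right_mono) auto
      finally show ?thesis .
    qed
    have c_L2: "c * L\<^sup>2 \<le> \<delta> * m * n\<^sup>2"
    proof -
      \<comment> \<open>The second moment error carries only one factor \<open>s\<close>. Enlarging
        it to the square, as \<open>s\<close> is at least 1, allows \<open>c_s\<close> to be used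
        again.\<close>
      have "real s \<le> (real s)\<^sup>2"
        using assms(1) by (simp add: power2_eq_square)
      then have "L\<^sup>2 \<le> (real s)\<^sup>2 * n\<^sup>2"
        using L2 mult_right_mono[of "real s" "(real s)\<^sup>2" "n\<^sup>2"] by simp
      then have "c * L\<^sup>2 \<le> c * (real s)\<^sup>2 * n\<^sup>2"
        using mult_left_mono[OF _ c] by (fastforce simp: mult_ac)
      also have "\<dots> \<le> \<delta> * m * n\<^sup>2"
        using c_s by (intro mult_right_mono) auto
      finally show ?thesis .
    qed
    have "\<bar>S2 - m * n\<^sup>2\<bar> \<le> c * L\<^sup>2"
      using second_moment_error[OF assms(3), of c x] assms(4) c
      by (simp add: S2_def L_def n2 m_def c_def)
    with c_L2 have S2_upper: "S2 \<le> (1 + \<delta>) * m * n\<^sup>2" and S2_lower: "(1 - \<delta>) * m * n\<^sup>2 \<le> S2"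
      by (auto simp: algebra_simps)
    have "S4 \<le> 3 * m * n ^ 4 + c * L ^ 4"
      using fourth_moment_le[OF assms(3), of c x] assms(4,5) c
      by (simp add: S4_def L_def n2 m_def c_def flip: power_mult)
    \<comment> \<open>The error is tripled so that the common factor 3 can be taken out, leaving 3 *
      (1 + \<delta>).\<close>
    also have "\<dots> \<le> 3 * m * n ^ 4 + 3 * (\<delta> * m * n ^ 4)"
    proof -
      have "0 \<le> \<delta> * m * n ^ 4" using assms(6) m by simp
      with c_L4 show ?thesis by linarith
    qed
    finally have S4: "S4 \<le> 3 * (1 + \<delta>) * m * n ^ 4"
      by (simp add: algebra_simps)
    have "S1\<^sup>2 \<le> m * S2"
      using Cauchy_Schwarz_ineq_sum[of "\<lambda>_. 1" "\<lambda>j. \<bar>(A *v x) $ j\<bar>" UNIV]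
      by (simp add: S1_def S2_def m_def)
    also have "\<dots> \<le> m * ((1 + \<delta>) * m * n\<^sup>2)"
      using S2_upper m by simp
    also have "\<dots> = (\<beta> * m * n)\<^sup>2"
      using assms(6) by (simp add: \<beta>_def power_mult_distrib) (simp add: power2_eq_square)
    finally have upper: "S1 \<le> \<beta> * m * n"
      by (rule power2_le_imp_le) (use n \<beta> m in simp)
    have lower: "\<alpha> * m * n \<le> S1"
    proof (cases "n = 0")
      case False
      \<comment> \<open>The bound for \<open>S4\<close> is to be cancelled at the end, hence the
        separate case \<open>n = 0\<close>, where it would vanish.\<close>
      define q where "q = 3 * (1 + \<delta>) * m * n ^ 4"
      have q: "0 < q" using False n assms(6) m by (simp add: q_def)
      have "\<alpha>\<^sup>2 * (3 * (1 + \<delta>)) = (1 - \<delta>) ^ 3"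
        using assms(6,7) by (simp add: \<alpha>_def)
      then have "(\<alpha> * m * n)\<^sup>2 * q = ((1 - \<delta>) * m * n\<^sup>2) ^ 3"
        unfolding q_def by algebra
      also have "\<dots> \<le> S2 ^ 3"
        using S2_lower assms(7) m by (intro power_mono) auto
      also have "\<dots> \<le> S1\<^sup>2 * S4"
        unfolding S1_def S2_def S4_def by (rule sum_cubed_power2_le)
      also have "\<dots> \<le> S1\<^sup>2 * q"
        using S4 by (intro mult_left_mono) (auto simp: q_def)
      finally have "(\<alpha> * m * n)\<^sup>2 \<le> S1\<^sup>2"
        using q by simp
      then show ?thesis using S1 by (rule power2_le_imp_le)
    qed (use S1 in simp)
    show ?thesis
      using upper lower by (simp add: lp_norm_1 lp_norm_2 S1_def n_def)
  qed
  show ?thesis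
    using \<alpha> \<beta> ratio bounds unfolding m_def by blast
qed

end
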